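(* For all integers $n\geq 0$ and $k\geq 1$, $$\overline{OPT}_{2k+1}(n)\equiv \overline{p}_o(n)\pmod 4.$$
   Context: An overpartition of a nonnegative integer $n$ is a non-increasing sequence of positive integers with sum $n$ in which the first occurrence of each number may be overlined. For an integer $k\geq 1$, an overpartition $k$-tuple of $n$ with odd parts is an (ordered) $k$-tuple $(\xi_1,\ldots,\xi_k)$ of overpartitions, all of whose parts are odd, such that the sum of all the parts of $\xi_1,\ldots,\xi_k$ is $n$. $\overline{OPT}_k(n)$ denotes the number of overpartition $k$-tuples of $n$ with odd parts. Its generating function is $$\sum_{n\geq 0}\overline{OPT}_k(n)q^n=\frac{f_2^{3k}}{f_1^{2k}f_4^k}=\prod_{i\geq 0}\left(\frac{1+q^{2i+1}}{1-q^{2i+1}}\right)^k,\qquad f_j:=\prod_{i\geq 1}(1-q^{ji}).$$ $\overline{p}_o(n):=\overline{OPT}_1(n)$ denotes the number of overpartitions of $n$ into odd parts. *)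

theory Defs
  imports Main "HOL-Number_Theory.Cong"
begin

text \<open>An overpartition is a list of pairs (part, overlined?). The last conjunct says that an
  overlined entry is the first occurrence of its value.\<close>

definition overpartition :: "(nat \<times> bool) list \<Rightarrow> bool" where
  "overpartition xs \<longleftrightarrow>
     sorted_wrt (\<ge>) (map fst xs) \<and>
     (\<forall>p \<in> set xs. fst p > 0) \<and>
     (\<forall>i j. i < j \<and> j < length xs \<and> snd (xs ! j) \<longrightarrow> fst (xs ! i) \<noteq> fst (xs ! j))"

definition parts_sum :: "(nat \<times> bool) list \<Rightarrow> nat" where
  "parts_sum xs = sum_list (map fst xs)"

definition odd_overpartition_tuples :: "nat \<Rightarrow> nat \<Rightarrow> (nat \<times> bool) list list set" where
  "odd_overpartition_tuples k n =
     {t. length t = k \<and>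
         (\<forall>x \<in> set t. overpartition x \<and> (\<forall>p \<in> set x. odd (fst p))) \<and>
         sum_list (map parts_sum t) = n}"

definition OPT :: "nat \<Rightarrow> nat \<Rightarrow> nat" where
  "OPT k n = card (odd_overpartition_tuples k n)"

definition p_o :: "nat \<Rightarrow> nat" where
  "p_o n = OPT 1 n"

text \<open>The cardinality in the definition of \<open>OPT\<close> is that of a finite set.\<close>

lemma length_le_parts_sum:
  assumes "\<forall>p \<in> set xs. fst p > 0"
  shows "length xs \<le> parts_sum xs"
  using assms by (induction xs) (auto simp: parts_sum_def)

lemma finite_odd_overpartition_tuples: "finite (odd_overpartition_tuples k n)"
proof -
  define A where "A = {xs. set xs \<subseteq> {..n} \<times> (UNIV :: bool set) \<and> length xs \<le> n}"
  have "finite A"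
    unfolding A_def by (rule finite_lists_length_le) simp
  then have "finite {t. set t \<subseteq> A \<and> length t = k}"
    by (rule finite_lists_length_eq)
  moreover have "odd_overpartition_tuples k n \<subseteq> {t. set t \<subseteq> A \<and> length t = k}"
  proof
    fix t assume t: "t \<in> odd_overpartition_tuples k n"
    have "x \<in> A" if x: "x \<in> set t" for x
    proof -
      have le: "parts_sum x \<le> n"
        using t x member_le_sum_list[of "parts_sum x" "map parts_sum t"]
        by (auto simp: odd_overpartition_tuples_def)
      have "fst p \<le> n" if "p \<in> set x" for p
        using that le member_le_sum_list[of "fst p" "map fst x"]
        by (auto simp: parts_sum_def)
      moreover have "length x \<le> n"
        using t x le length_le_parts_sum[of x]
        by (fastforce simp: odd_overpartition_tuples_def overpartition_def)
      ultimately show ?thesis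
        by (force simp: A_def)
    qed
    with t show "t \<in> {t. set t \<subseteq> A \<and> length t = k}"
      by (auto simp: odd_overpartition_tuples_def)
  qed
  ultimately show ?thesis
    by (rule finite_subset[rotated])
qed

end

theory Submission
  imports Defs "HOL-Computational_Algebra.Formal_Power_Series"
begin

text \<open>Toggling the overline on the largest part is a fixed-point-free involution on the nonempty
  overpartitions. Hence the generating function \<open>F\<close> of overpartitions into odd parts has the form
  \<open>1 + 2 S\<close>, so that \<open>F\<^sup>2 = 1 + 4 (S + S\<^sup>2)\<close> and \<open>F ^ (2 k + 1)\<close> is congruent to \<open>F\<close> modulo 4.\<close>

definition odd_overpartitions :: "nat \<Rightarrow> (nat \<times> bool) list set" where
  "odd_overpartitions n = {x. overpartition x \<and> (\<forall>p \<in> set x. odd (fst p)) \<and> parts_sum x = n}"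

text \<open>The head is always the first occurrence of its value, so its overline is
  unconstrained.\<close>

lemma overpartition_Cons_overline:
  assumes "overpartition ((a, b) # xs)"
  shows "overpartition ((a, c) # xs)"
  unfolding overpartition_def
proof (intro conjI allI impI)
  show "sorted_wrt (\<ge>) (map fst ((a, c) # xs))" "\<forall>p \<in> set ((a, c) # xs). fst p > 0"
    using assms by (auto simp: overpartition_def)
  fix i j
  assume ij: "i < j \<and> j < length ((a, c) # xs) \<and> snd (((a, c) # xs) ! j)"
  \<comment> \<open>Since \<open>i < j\<close>, entry \<open>j\<close> lies in the tail, where the
    two lists agree; the entries at \<open>i\<close> can differ only in the overline.\<close>
  then obtain j' where j': "j = Suc j'"
    by (cases j) auto
  have "fst (((a, b) # xs) ! i) \<noteq> fst (((a, b) # xs) ! j)"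
    using assms ij j' unfolding overpartition_def
    by (metis length_Cons nth_Cons_Suc)
  then show "fst (((a, c) # xs) ! i) \<noteq> fst (((a, c) # xs) ! j)"
    by (cases i) (auto simp: j')
qed

lemma odd_overpartitions_Cons_overline:
  "(a, b) # xs \<in> odd_overpartitions n \<Longrightarrow> (a, c) # xs \<in> odd_overpartitions n"
  by (auto simp: odd_overpartitions_def parts_sum_def intro: overpartition_Cons_overline)

lemma odd_overpartition_tuples_0:
  "odd_overpartition_tuples 0 n = (if n = 0 then {[]} else {})"
  by (auto simp: odd_overpartition_tuples_def)

text \<open>Splitting off the first component and sorting by its size \<open>i\<close> prepares the
  Cauchy product of generating functions.\<close>

lemma odd_overpartition_tuples_Suc:
  "odd_overpartition_tuples (Suc k) n =
     (\<Union>i\<in>{0..n}. (\<lambda>(x, t). x # t) ` (odd_overpartitions i \<times> odd_overpartition_tuples k (n - i)))"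
    (is "?L = ?R")
proof
  show "?L \<subseteq> ?R"
  proof
    fix t assume t: "t \<in> ?L"
    then obtain x u where xu: "t = x # u"
      by (cases t) (auto simp: odd_overpartition_tuples_def)
    have "parts_sum x \<in> {0..n}" "x \<in> odd_overpartitions (parts_sum x)"
      "u \<in> odd_overpartition_tuples k (n - parts_sum x)"
      using t xu by (auto simp: odd_overpartition_tuples_def odd_overpartitions_def)
    then show "t \<in> ?R"
      unfolding xu by force
  qed
  show "?R \<subseteq> ?L"
    by (fastforce simp: odd_overpartition_tuples_def odd_overpartitions_def)
qed

lemma finite_odd_overpartitions: "finite (odd_overpartitions n)"
proof -
  have "(\<lambda>x. [x]) ` odd_overpartitions n \<subseteq> odd_overpartition_tuples 1 n"
    by (auto simp: odd_overpartition_tuples_def odd_overpartitions_def)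
  then have "finite ((\<lambda>x. [x]) ` odd_overpartitions n)"
    using finite_odd_overpartition_tuples by (rule finite_subset)
  then show ?thesis
    by (rule finite_imageD) (auto simp: inj_on_def)
qed

lemma OPT_Suc: "OPT (Suc k) n = (\<Sum>i=0..n. card (odd_overpartitions i) * OPT k (n - i))"
proof -
  let ?B = "\<lambda>i. (\<lambda>(x, t). x # t) ` (odd_overpartitions i \<times> odd_overpartition_tuples k (n - i))"
  have "OPT (Suc k) n = (\<Sum>i=0..n. card (?B i))"
    unfolding OPT_def odd_overpartition_tuples_Suc
  proof (rule card_UN_disjoint)
    show "\<forall>i\<in>{0..n}. finite (?B i)"
      by (simp add: finite_odd_overpartitions finite_odd_overpartition_tuples)
    \<comment> \<open>The first component of a tuple determines \<open>i\<close> as its sum.\<close>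
    show "\<forall>i\<in>{0..n}. \<forall>j\<in>{0..n}. i \<noteq> j \<longrightarrow> ?B i \<inter> ?B j = {}"
      by (auto simp: odd_overpartitions_def)
  qed simp
  also have "\<dots> = (\<Sum>i=0..n. card (odd_overpartitions i) * OPT k (n - i))"
    unfolding OPT_def
    by (intro sum.cong refl, subst card_image) (auto simp: inj_on_def card_cartesian_product)
  finally show ?thesis .
qed

lemma odd_overpartitions_0: "odd_overpartitions 0 = {[]}"
proof -
  have "x = []" if "x \<in> odd_overpartitions 0" for x
    using that length_le_parts_sum[of x] by (simp add: odd_overpartitions_def overpartition_def)
  moreover have "[] \<in> odd_overpartitions 0"
    by (simp add: odd_overpartitions_def overpartition_def parts_sum_def)
  ultimately show ?thesis by blast
qed

lemma even_card_odd_overpartitions: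
  assumes "n > 0"
  shows "even (card (odd_overpartitions n))"
proof -
  define U where "U b = {x \<in> odd_overpartitions n. snd (hd x) = b}" for b
  \<comment> \<open>Parts are non-increasing, so \<open>h\<close> toggles the overline on a largest
    part. It is its own inverse on nonempty lists and exchanges \<open>U True\<close> with
    \<open>U False\<close>.\<close>
  define h :: "(nat \<times> bool) list \<Rightarrow> _" where "h x = (fst (hd x), \<not> snd (hd x)) # tl x" for x
  \<comment> \<open>Positivity of \<open>n\<close> excludes the empty list, which has no part to
    toggle.\<close>
  have ne: "x \<noteq> []" if "x \<in> odd_overpartitions n" for x
    using that assms by (auto simp: odd_overpartitions_def parts_sum_def)
  have h: "h x \<in> U (\<not> b)" "h (h x) = x" if "x \<in> U b" for x b
    using that ne[of x]
    by (cases x; auto simp: U_def h_def intro: odd_overpartitions_Cons_overline)+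
  have fin: "finite (U b)" for b
    by (simp add: U_def finite_odd_overpartitions)
  have "bij_betw h (U True) (U False)"
    by (rule bij_betw_byWitness[where f' = h]) (use h(2) h(1)[of _ True] h(1)[of _ False] in auto)
  then have "card (U True) = card (U False)"
    by (rule bij_betw_same_card)
  moreover have "odd_overpartitions n = U True \<union> U False"
    by (auto simp: U_def)
  moreover have "card (U True \<union> U False) = card (U True) + card (U False)"
    by (intro card_Un_disjoint fin) (auto simp: U_def)
  ultimately show ?thesis by simp
qed

text \<open>This is the series \<open>F\<close>; integer coefficients make subtraction and
  divisibility by 4 available.\<close>

definition odd_overpartition_fps :: "int fps" where
  "odd_overpartition_fps = Abs_fps (\<lambda>n. int (card (odd_overpartitions n)))"

text \<open>The recurrence \<open>OPT_Suc\<close> is exactly the coefficient rule for multiplication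
  by \<open>F\<close>.\<close>

lemma fps_nth_odd_overpartition_fps_power:
  "fps_nth (odd_overpartition_fps ^ k) n = int (OPT k n)"
proof (induction k arbitrary: n)
  case 0
  then show ?case by (simp add: OPT_def odd_overpartition_tuples_0)
next
  case (Suc k)
  then show ?case
    by (simp add: fps_mult_nth OPT_Suc odd_overpartition_fps_def)
qed

lemma four_dvd_odd_overpartition_fps_square:
  "4 dvd odd_overpartition_fps ^ 2 - 1"
proof -
  define S where "S = Abs_fps (\<lambda>n. fps_nth (odd_overpartition_fps - 1) n div 2)"
  have "even (fps_nth (odd_overpartition_fps - 1) n)" for n
    \<comment> \<open>At \<open>n = 0\<close> the empty overpartition contributes 1, which the
      subtraction cancels.\<close>
    by (cases "n = 0")
      (auto simp: odd_overpartition_fps_def odd_overpartitions_0 even_card_odd_overpartitions)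
  then have "odd_overpartition_fps - 1 = 2 * S"
    by (intro fps_ext) (simp add: S_def numeral_fps_const del: fps_sub_nth)
  then have "odd_overpartition_fps = 1 + 2 * S"
    by (simp add: algebra_simps)
  then have "odd_overpartition_fps ^ 2 - 1 = (1 + 2 * S) ^ 2 - 1"
    by simp
  also have "\<dots> = 4 * (S + S ^ 2)"
    by (simp add: power2_sum power_mult_distrib distrib_left)
  finally show ?thesis by simp
qed

theorem theorem2p8:
  fixes n k :: nat
  assumes "k \<ge> 1"
  shows "[OPT (2 * k + 1) n = p_o n] (mod 4)"
proof -
  let ?F = odd_overpartition_fps
  \<comment> \<open>Here \<open>x - 1\<close> divides \<open>x ^ k - 1\<close>, with
    \<open>x\<close> the square of \<open>F\<close>.\<close>
  have "?F ^ 2 - 1 dvd (?F ^ 2) ^ k - 1"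
    by (simp add: power_diff_1_eq)
  then have "4 dvd ?F * ((?F ^ 2) ^ k - 1)"
    using four_dvd_odd_overpartition_fps_square by (meson dvd_mult dvd_trans)
  \<comment> \<open>Keeping \<open>?F ^ 1\<close> lets the power lemma read both terms as values of
    \<open>OPT\<close>, the second being \<open>p_o\<close>.\<close>
  also have "?F * ((?F ^ 2) ^ k - 1) = ?F ^ (2 * k + 1) - ?F ^ 1"
    by (simp add: algebra_simps flip: power_mult)
  finally obtain G where "?F ^ (2 * k + 1) - ?F ^ 1 = 4 * G" ..
  then have "fps_nth (?F ^ (2 * k + 1)) n - fps_nth (?F ^ 1) n = fps_nth (4 * G) n"
    by (metis fps_sub_nth)
  then have "int (OPT (2 * k + 1) n) - int (p_o n) = 4 * fps_nth G n"
    unfolding fps_nth_odd_overpartition_fps_power p_o_def by (simp add: numeral_fps_const)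
  \<comment> \<open>The modulus has the form \<open>int 4\<close> so that
    \<open>cong_int_iff\<close> returns to the naturals.\<close>
  then have "[int (OPT (2 * k + 1) n) = int (p_o n)] (mod int 4)"
    by (simp add: cong_iff_dvd_diff)
  then show ?thesis
    by (simp only: cong_int_iff)
qed

end
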